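(* Let $\epsilon\in(0,1)$, let $\mathbf M\in\mathbb R^{d\times d}$ be symmetric positive semidefinite, let $k\in\{1,\dots,d\}$, and let $\mathcal O$ be an $\epsilon$-approximate $1$-ePCA oracle. Then the deflation algorithm $\mathsf{BlackBoxPCA}(\mathbf M,k,\mathcal O)$ returns $\mathbf U\in\mathbb R^{d\times k}$ which is an $\epsilon$-approximate energy $k$-PCA ($\epsilon$-$k$-ePCA) of $\mathbf M$.
   Context: A matrix $\mathbf V\in\mathbb R^{d\times r}$ is orthonormal if $\mathbf V^\top\mathbf V=\mathbf I_r$. $\langle\mathbf A,\mathbf B\rangle=\mathrm{Tr}(\mathbf A\mathbf B)$ for symmetric $\mathbf A,\mathbf B$. For symmetric positive semidefinite $\mathbf M\in\mathbb R^{d\times d}$, $\|\mathbf M\|_k:=\max_{\text{orthonormal }\mathbf V\in\mathbb R^{d\times k}}\langle\mathbf V\mathbf V^\top,\mathbf M\rangle$ (the sum of the $k$ largest eigenvalues). Energy $k$-PCA: for $\epsilon\in[0,1]$, an orthonormal $\mathbf U\in\mathbb R^{d\times k}$ is an $\epsilon$-$k$-ePCA of $\mathbf M$ if $\langle\mathbf U\mathbf U^\top,\mathbf M\rangle\ge(1-\epsilon)\|\mathbf M\|_k$. ePCA oracle: $\mathcal O$ is an $\epsilon$-approximate $1$-ePCA oracle if, on any inputs $\mathbf M$ (a $d\times d$ symmetric positive semidefinite matrix) and $\mathbf P$ (a $d\times d$ orthogonal projection matrix), it returns a unit vector $u\in\mathrm{span}(\mathbf P)$ (the column span of $\mathbf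 P$) which is an $\epsilon$-$1$-ePCA of $\mathbf P\mathbf M\mathbf P$. Algorithm $\mathsf{BlackBoxPCA}(\mathbf M,k,\mathcal O)$: set $\mathbf P_0=\mathbf I_d$; for $i=1,\dots,k$: let $u_i=\mathcal O(\mathbf M,\mathbf P_{i-1})$ and $\mathbf P_i=\mathbf P_{i-1}-u_iu_i^\top$. Return $\mathbf U\in\mathbb R^{d\times k}$ with columns $u_1,\dots,u_k$. *)

theory Defs
  imports Complex_Main "Jordan_Normal_Form.VS_Connect"
begin

definition mat_trace :: "real mat \<Rightarrow> real" where
  "mat_trace A = (\<Sum>i<dim_row A. A $$ (i, i))"

definition mat_inner :: "real mat \<Rightarrow> real mat \<Rightarrow> real" where
  "mat_inner A B = mat_trace (A * B)"

definition orthonormal_cols :: "nat \<Rightarrow> nat \<Rightarrow> real mat \<Rightarrow> bool" where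
  "orthonormal_cols d r V \<longleftrightarrow> V \<in> carrier_mat d r \<and> V\<^sup>T * V = 1\<^sub>m r"

definition psd_mat :: "nat \<Rightarrow> real mat \<Rightarrow> bool" where
  "psd_mat d M \<longleftrightarrow> M \<in> carrier_mat d d \<and> M\<^sup>T = M \<and>
     (\<forall>v \<in> carrier_vec d. 0 \<le> v \<bullet> (M *\<^sub>v v))"

definition orth_proj_mat :: "nat \<Rightarrow> real mat \<Rightarrow> bool" where
  "orth_proj_mat d P \<longleftrightarrow> P \<in> carrier_mat d d \<and> P\<^sup>T = P \<and> P * P = P"

text \<open>For a \<open>d \<times> d\<close> matrix and \<open>k \<le> d\<close> the set of orthonormal \<open>V\<close> is nonempty and compact,
  so the supremum is a maximum.\<close>
definition top_norm :: "nat \<Rightarrow> nat \<Rightarrow> real mat \<Rightarrow> real" where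
  "top_norm d k M = (SUP V \<in> {V. orthonormal_cols d k V}. mat_inner (V * V\<^sup>T) M)"

definition is_epca :: "nat \<Rightarrow> nat \<Rightarrow> real \<Rightarrow> real mat \<Rightarrow> real mat \<Rightarrow> bool" where
  "is_epca d k \<epsilon> M U \<longleftrightarrow> orthonormal_cols d k U \<and>
     mat_inner (U * U\<^sup>T) M \<ge> (1 - \<epsilon>) * top_norm d k M"

text \<open>The zero projection is excluded as an input: its column space contains no unit vector, so no
  oracle could answer on it. A vector is regarded as a one-column matrix through
  \<open>mat_of_cols d [u]\<close>.\<close>
definition is_epca_oracle :: "nat \<Rightarrow> real \<Rightarrow> (real mat \<Rightarrow> real mat \<Rightarrow> real vec) \<Rightarrow> bool" where
  "is_epca_oracle d \<epsilon> orc \<longleftrightarrow>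
     (\<forall>M P. psd_mat d M \<longrightarrow> orth_proj_mat d P \<longrightarrow> P \<noteq> 0\<^sub>m d d \<longrightarrow>
        orc M P \<in> vec_space.col_space d P \<and>
        orc M P \<bullet> orc M P = 1 \<and>
        is_epca d 1 \<epsilon> (P * M * P) (mat_of_cols d [orc M P]))"

primrec deflation_proj ::
  "nat \<Rightarrow> real mat \<Rightarrow> (real mat \<Rightarrow> real mat \<Rightarrow> real vec) \<Rightarrow> nat \<Rightarrow> real mat" where
  "deflation_proj d M orc 0 = 1\<^sub>m d"
| "deflation_proj d M orc (Suc i) =
     (let P = deflation_proj d M orc i;
          u = mat_of_cols d [orc M P]
      in P - u * u\<^sup>T)"

definition black_box_pca ::
  "nat \<Rightarrow> real mat \<Rightarrow> nat \<Rightarrow> (real mat \<Rightarrow> real mat \<Rightarrow> real vec) \<Rightarrow> real mat" where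
  "black_box_pca d M k orc =
     mat_of_cols d (map (\<lambda>i. orc M (deflation_proj d M orc i)) [0..<k])"

end

theory Submission
  imports Defs
begin

text \<open>
  Deflation loses nothing because removing one direction \<open>u\<close> from the ambient space costs an
  orthonormal frame at most one top direction. Let \<open>W\<close> be an \<open>m\<close>-dimensional subspace of the range
  of a projection \<open>P\<close>, with orthogonal projection \<open>Q\<close>, and let \<open>u\<close> be any unit vector in the range
  of \<open>P\<close>. Write \<open>W\<close> as the orthogonal sum of a line spanned by a unit vector \<open>w\<close> in the direction
  \<open>Q u\<close> (any line in \<open>W\<close> if \<open>Q u = 0\<close>) and an \<open>(m - 1)\<close>-dimensional subspace orthogonal to \<open>u\<close>.
  The energy of \<open>M\<close> on \<open>W\<close> is the sum of the energies on the two parts. The line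
  contributes at most the top energy of \<open>P M P\<close>, which the oracle's answer \<open>u\<close> recovers up to the
  factor \<open>1 - \<epsilon>\<close>; the rest lies in the range of the next deflated projection \<open>P - u u\<^sup>T\<close>, so
  induction on \<open>m\<close> applies (\<open>energy_of_subprojection\<close>).

  Subspaces are represented by their orthogonal projections and dimension by the trace. This makes
  splitting off a line the subtraction of \<open>w w\<^sup>T\<close> (\<open>orth_proj_mat_deflate\<close>), the same operation
  that the algorithm performs, and \<open>ex_unit_capturing_projection\<close> supplies the line. An orthonormal
  \<open>V\<close> with \<open>k\<close> columns enters as \<open>Q = V V\<^sup>T\<close>, a projection of trace \<open>k\<close>, while the output \<open>U\<close>
  satisfies \<open>U U\<^sup>T = P\<^sub>0 - P\<^sub>k\<close>; the induction started at \<open>P\<^sub>0\<close>, the identity, therefore compares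
  \<open>U\<close> with every competitor \<open>V\<close>.
\<close>

section \<open>Matrix identities and traces\<close>

lemma minus_zero_right_mat [simp]:
  fixes A :: "'a :: group_add mat"
  shows "A \<in> carrier_mat n m \<Longrightarrow> A - 0\<^sub>m n m = A"
  by (intro eq_matI) auto

lemma mat_of_single_col_carrier [simp]: "mat_of_cols d [x] \<in> carrier_mat d (Suc 0)"
  by (rule carrier_matI) auto

lemma mat_trace_mult_commute:
  assumes "A \<in> carrier_mat n m" "B \<in> carrier_mat m n"
  shows "mat_trace (A * B) = mat_trace (B * A)"
proof -
  have "mat_trace (A * B) = (\<Sum>i<n. \<Sum>j<m. A $$ (i, j) * B $$ (j, i))"
    using assms by (auto simp: mat_trace_def scalar_prod_def atLeast0LessThan intro!: sum.cong)
  also have "\<dots> = (\<Sum>j<m. \<Sum>i<n. B $$ (j, i) * A $$ (i, j))"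
    by (subst sum.swap) (simp add: mult.commute)
  also have "\<dots> = mat_trace (B * A)"
    using assms by (auto simp: mat_trace_def scalar_prod_def atLeast0LessThan intro!: sum.cong)
  finally show ?thesis .
qed

lemma mat_trace_minus:
  assumes "A \<in> carrier_mat n n" "B \<in> carrier_mat n n"
  shows "mat_trace (A - B) = mat_trace A - mat_trace B"
  using assms by (auto simp: mat_trace_def sum_subtractf[symmetric] intro!: sum.cong)

lemma mat_inner_minus_left:
  assumes "A \<in> carrier_mat n n" "B \<in> carrier_mat n n" "M \<in> carrier_mat n n"
  shows "mat_inner (A - B) M = mat_inner A M - mat_inner B M"
  using assms
  by (simp add: mat_inner_def minus_mult_distrib_mat[OF assms] mat_trace_minus[of _ n])

lemma mat_trace_one [simp]: "mat_trace (1\<^sub>m n) = real n"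
  by (simp add: mat_trace_def)

section \<open>Orthogonal projections and their rank\<close>

lemma orth_proj_mat_one: "orth_proj_mat d (1\<^sub>m d)"
  by (simp add: orth_proj_mat_def)

lemma orth_proj_mat_of_orthonormal_cols:
  assumes "orthonormal_cols d k V"
  shows "orth_proj_mat d (V * V\<^sup>T)" and "mat_trace (V * V\<^sup>T) = real k"
proof -
  have V: "V \<in> carrier_mat d k" and VV: "V\<^sup>T * V = 1\<^sub>m k"
    using assms by (auto simp: orthonormal_cols_def)
  have VT: "V\<^sup>T \<in> carrier_mat k d" using V by simp
  have "V * V\<^sup>T * (V * V\<^sup>T) = V * (V\<^sup>T * V * V\<^sup>T)"
    using V VT by (simp add: assoc_mult_mat[of _ d k _ d _ d] assoc_mult_mat[of _ k d _ k _ d])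
  also have "\<dots> = V * V\<^sup>T" using V VT VV by simp
  finally show "orth_proj_mat d (V * V\<^sup>T)"
    using V VT by (simp add: orth_proj_mat_def transpose_mult[OF V VT])
  show "mat_trace (V * V\<^sup>T) = real k"
    using mat_trace_mult_commute[OF V VT] VV by simp
qed

lemma orth_proj_mat_deflate:
  assumes "orth_proj_mat d Q" "orthonormal_cols d 1 w" "Q * w = w"
  shows "orth_proj_mat d (Q - w * w\<^sup>T)"
    and "mat_trace (Q - w * w\<^sup>T) = mat_trace Q - 1"
proof -
  let ?R = "w * w\<^sup>T"
  have Q: "Q \<in> carrier_mat d d" "Q\<^sup>T = Q" "Q * Q = Q"
    using assms(1) by (auto simp: orth_proj_mat_def)
  have w: "w \<in> carrier_mat d 1" "w\<^sup>T \<in> carrier_mat 1 d"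
    using assms(2) by (auto simp: orthonormal_cols_def)
  have R: "?R \<in> carrier_mat d d" "?R\<^sup>T = ?R" "?R * ?R = ?R" "mat_trace ?R = 1"
    using orth_proj_mat_of_orthonormal_cols[OF assms(2)] by (auto simp: orth_proj_mat_def)
  have QR: "Q * ?R = ?R"
    using assms(3) assoc_mult_mat[OF Q(1) w] by simp
  have RQ: "?R * Q = ?R"
    using arg_cong[OF QR, of transpose_mat] transpose_mult[OF Q(1) R(1)] Q R by simp
  have "(Q - ?R) * (Q - ?R) = Q * (Q - ?R) - ?R * (Q - ?R)"
    using minus_mult_distrib_mat[OF Q(1) R(1) minus_carrier_mat[OF R(1)]] .
  also have "\<dots> = Q - ?R - (?R - ?R)"
    using mult_minus_distrib_mat[OF Q(1) Q(1) R(1)] mult_minus_distrib_mat[OF R(1) Q(1) R(1)]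
    unfolding Q(3) QR RQ R(3) by argo
  also have "\<dots> = Q - ?R" using Q R by (intro eq_matI) auto
  finally have "(Q - ?R) * (Q - ?R) = Q - ?R" .
  then show "orth_proj_mat d (Q - ?R)"
    using Q R transpose_minus[OF Q(1) R(1)] minus_carrier_mat[OF R(1), of Q]
    by (simp add: orth_proj_mat_def)
  show "mat_trace (Q - ?R) = mat_trace Q - 1"
    using mat_trace_minus[OF Q(1) R(1)] R by simp
qed

text \<open>The trace of a projection \<open>Q = Q\<^sup>T Q\<close> is the sum of the squares of its entries.\<close>

lemma orth_proj_mat_trace_zero:
  assumes "orth_proj_mat d Q" "mat_trace Q = 0"
  shows "Q = 0\<^sub>m d d"
proof -
  have Q: "Q \<in> carrier_mat d d" "Q\<^sup>T = Q" "Q * Q = Q"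
    using assms(1) by (auto simp: orth_proj_mat_def)
  have "mat_trace (Q\<^sup>T * Q) = (\<Sum>i<d. \<Sum>j<d. (Q $$ (j, i))\<^sup>2)"
    using Q(1) by (auto simp: mat_trace_def scalar_prod_def atLeast0LessThan power2_eq_square
        intro!: sum.cong)
  then have "(\<Sum>i<d. \<Sum>j<d. (Q $$ (j, i))\<^sup>2) = 0"
    using Q(2,3) assms(2) by simp
  then have "\<forall>i<d. \<forall>j<d. Q $$ (j, i) = 0"
    by (auto simp: sum_nonneg_eq_0_iff sum_nonneg)
  then show ?thesis using Q(1) by auto
qed

text \<open>The second property records that the rank-one projection onto the line of \<open>x\<close> fixes \<open>x\<close>; it is
  bracketed so that no \<open>d \<times> d\<close> product is formed.\<close>

lemma ex_normalization:
  assumes x: "x \<in> carrier_mat d 1" "x \<noteq> 0\<^sub>m d 1"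
  obtains c where "orthonormal_cols d 1 (c \<cdot>\<^sub>m x)"
    and "(c \<cdot>\<^sub>m x) * ((c \<cdot>\<^sub>m x)\<^sup>T * x) = x"
proof -
  define s where "s = (\<Sum>i<d. (x $$ (i, 0))\<^sup>2)"
  have xx: "x\<^sup>T * x = s \<cdot>\<^sub>m 1\<^sub>m 1"
    using x by (intro eq_matI)
      (auto simp: s_def scalar_prod_def atLeast0LessThan power2_eq_square intro!: sum.cong)
  have "s \<noteq> 0"
    using x by (auto simp: s_def sum_nonneg_eq_0_iff)
  moreover have "s \<ge> 0" by (auto simp: s_def intro: sum_nonneg)
  ultimately have s: "s > 0" by simp
  define c where "c = 1 / sqrt s"
  have cc: "c * (c * s) = 1" using s by (simp add: c_def field_simps)
  have cT: "(c \<cdot>\<^sub>m x)\<^sup>T * y = c \<cdot>\<^sub>m (x\<^sup>T * y)" if "y \<in> carrier_mat d 1" for y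
  proof -
    have "(c \<cdot>\<^sub>m x)\<^sup>T = c \<cdot>\<^sub>m x\<^sup>T" by (intro eq_matI) auto
    then show ?thesis using x that by (simp add: mult_smult_assoc_mat[of _ 1 d _ 1])
  qed
  have "orthonormal_cols d 1 (c \<cdot>\<^sub>m x)"
    using x xx cc by (simp add: orthonormal_cols_def cT mult_smult_distrib[of _ 1 d _ 1])
       (auto intro!: eq_matI)
  moreover have "(c \<cdot>\<^sub>m x) * ((c \<cdot>\<^sub>m x)\<^sup>T * x) = x"
    using x cc unfolding cT[OF x(1)] xx
    by (intro eq_matI) (auto simp: scalar_prod_def mult.assoc ac_simps)
  ultimately show thesis using that by blast
qed

text \<open>The equation \<open>w w\<^sup>T u = Q u\<close> says that \<open>Q - w w\<^sup>T\<close> annihilates \<open>u\<close>, so what is left of the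
  range of \<open>Q\<close> after removing \<open>w\<close> is orthogonal to \<open>u\<close>. The vector \<open>w\<close> is \<open>Q u\<close> normalized; if
  \<open>Q u = 0\<close>, every unit vector in the range of \<open>Q\<close> is already orthogonal to \<open>u\<close> and any will do.\<close>

lemma ex_unit_capturing_projection:
  assumes "orth_proj_mat d Q" "Q \<noteq> 0\<^sub>m d d" and u: "u \<in> carrier_mat d 1"
  obtains w where "orthonormal_cols d 1 w" "Q * w = w" "w * (w\<^sup>T * u) = Q * u"
proof -
  have Q: "Q \<in> carrier_mat d d" "Q\<^sup>T = Q" "Q * Q = Q"
    using assms(1) by (auto simp: orth_proj_mat_def)
  \<comment> \<open>A vector in the range of \<open>Q\<close> sees \<open>u\<close> only through \<open>Q u\<close>.\<close>
  have move: "w\<^sup>T * u = w\<^sup>T * (Q * u)" if "w \<in> carrier_mat d 1" "Q * w = w" for w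
  proof -
    have "w\<^sup>T = w\<^sup>T * Q" using transpose_mult[OF Q(1) that(1)] that Q by simp
    then show ?thesis
      using assoc_mult_mat[of "w\<^sup>T" 1 d Q d u 1] that Q u by simp
  qed
  have fixed: "Q * (c \<cdot>\<^sub>m (Q * y)) = c \<cdot>\<^sub>m (Q * y)" if "y \<in> carrier_mat d 1" for c y
    using Q that
    by (simp add: mult_smult_distrib[of _ d d _ 1] assoc_mult_mat[of Q d d Q d y 1, symmetric])
  show thesis
  proof (cases "Q * u = 0\<^sub>m d 1")
    case False
    obtain c where c: "orthonormal_cols d 1 (c \<cdot>\<^sub>m (Q * u))"
      "(c \<cdot>\<^sub>m (Q * u)) * ((c \<cdot>\<^sub>m (Q * u))\<^sup>T * (Q * u)) = Q * u"
      using ex_normalization[OF _ False] Q u by (metis mult_carrier_mat)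
    have "c \<cdot>\<^sub>m (Q * u) \<in> carrier_mat d 1" using Q u by simp
    from that[OF c(1) fixed[OF u]] move[OF this fixed[OF u]] c(2) show thesis by simp
  next
    case True
    have "\<exists>y \<in> carrier_mat d 1. Q * y \<noteq> 0\<^sub>m d 1"
    proof (rule ccontr)
      assume "\<not> ?thesis"
      then have z: "Q * mat_of_cols d [unit_vec d j] = 0\<^sub>m d 1" for j by auto
      have "Q $$ (i, j) = 0" if "i < d" "j < d" for i j
      proof -
        have "(Q * mat_of_cols d [unit_vec d j]) $$ (i, 0) = row Q i \<bullet> unit_vec d j"
          using Q that by simp
        also have "\<dots> = Q $$ (i, j)" using Q that by simp
        finally show ?thesis using z that by simp
      qed
      then have "Q = 0\<^sub>m d d" using Q by auto
      then show False using assms(2) by simp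
    qed
    then obtain y where y: "y \<in> carrier_mat d 1" "Q * y \<noteq> 0\<^sub>m d 1" by blast
    obtain c where c: "orthonormal_cols d 1 (c \<cdot>\<^sub>m (Q * y))"
      using ex_normalization[OF _ y(2)] Q y by (metis mult_carrier_mat)
    have w: "c \<cdot>\<^sub>m (Q * y) \<in> carrier_mat d 1" using Q y by simp
    have "c \<cdot>\<^sub>m (Q * y) * ((c \<cdot>\<^sub>m (Q * y))\<^sup>T * u) = Q * u"
      unfolding move[OF w fixed[OF y(1)]] True
      using w right_mult_zero_mat[of "(c \<cdot>\<^sub>m (Q * y))\<^sup>T" 1 d 1]
        right_mult_zero_mat[OF w, of 1] by simp
    from that[OF c fixed[OF y(1)] this] show thesis .
  qed
qed

section \<open>Rank-one energies\<close>

text \<open>A supremum of reals bounds its members only if they are bounded above. The crude bound by the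
  sum of the absolute entries of \<open>N\<close> suffices, since a unit vector has entries of modulus at most
  one.\<close>

lemma bdd_above_rank_one_energy:
  assumes N: "N \<in> carrier_mat d d"
  shows "bdd_above ((\<lambda>V. mat_inner (V * V\<^sup>T) N) ` {V. orthonormal_cols d 1 V})"
proof (rule bdd_aboveI2)
  fix V assume "V \<in> {V. orthonormal_cols d 1 V}"
  then have V: "V \<in> carrier_mat d 1" and "V\<^sup>T * V = 1\<^sub>m 1"
    by (auto simp: orthonormal_cols_def)
  then have "(V\<^sup>T * V) $$ (0, 0) = 1" by simp
  then have sq: "(\<Sum>i<d. (V $$ (i, 0))\<^sup>2) = 1"
    using V by (simp add: scalar_prod_def atLeast0LessThan power2_eq_square)
  have le1: "\<bar>V $$ (i, 0)\<bar> \<le> 1" if "i < d" for i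
  proof -
    have "(V $$ (i, 0))\<^sup>2 \<le> (\<Sum>i<d. (V $$ (i, 0))\<^sup>2)"
      using that by (intro member_le_sum) auto
    then show ?thesis using sq by (simp add: abs_square_le_1)
  qed
  have "mat_inner (V * V\<^sup>T) N = (\<Sum>i<d. \<Sum>j<d. V $$ (i, 0) * V $$ (j, 0) * N $$ (j, i))"
    using V N by (auto simp: mat_inner_def mat_trace_def scalar_prod_def atLeast0LessThan
        sum_distrib_left mult.assoc
        intro!: sum.cong)
  also have "\<dots> \<le> (\<Sum>i<d. \<Sum>j<d. \<bar>N $$ (j, i)\<bar>)"
  proof (intro sum_mono)
    fix i j assume "i \<in> {..<d}" "j \<in> {..<d}"
    then have "\<bar>V $$ (i, 0)\<bar> * \<bar>V $$ (j, 0)\<bar> \<le> 1"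
      using le1 by (intro mult_le_one) auto
    then have "\<bar>V $$ (i, 0)\<bar> * \<bar>V $$ (j, 0)\<bar> * \<bar>N $$ (j, i)\<bar> \<le> \<bar>N $$ (j, i)\<bar>"
      by (intro mult_left_le_one_le) auto
    then show "V $$ (i, 0) * V $$ (j, 0) * N $$ (j, i) \<le> \<bar>N $$ (j, i)\<bar>"
      by (metis abs_mult abs_ge_self order_trans)
  qed
  finally show "mat_inner (V * V\<^sup>T) N \<le> (\<Sum>i<d. \<Sum>j<d. \<bar>N $$ (j, i)\<bar>)" .
qed

text \<open>Translates the oracle's guarantee, which concerns \<open>P M P\<close>, into one about \<open>M\<close> itself.\<close>

lemma rank_one_energy_compress:
  assumes P: "orth_proj_mat d P" and M: "M \<in> carrier_mat d d"
    and w: "w \<in> carrier_mat d 1" "P * w = w"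
  shows "mat_inner (w * w\<^sup>T) (P * M * P) = mat_inner (w * w\<^sup>T) M"
proof -
  have P': "P \<in> carrier_mat d d" "P\<^sup>T = P" using P by (auto simp: orth_proj_mat_def)
  have wT: "w\<^sup>T \<in> carrier_mat 1 d" using w by simp
  have wP: "w\<^sup>T * P = w\<^sup>T" using transpose_mult[OF P'(1) w(1)] w P' by simp
  have energy: "mat_inner (w * w\<^sup>T) N = mat_trace (w\<^sup>T * (N * w))" if N: "N \<in> carrier_mat d d" for N
  proof -
    have "mat_inner (w * w\<^sup>T) N = mat_trace (w * (w\<^sup>T * N))"
      using assoc_mult_mat[OF w(1) wT N] by (simp add: mat_inner_def)
    also have "\<dots> = mat_trace (w\<^sup>T * N * w)"
      using w wT N by (intro mat_trace_mult_commute[of _ d 1]) auto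
    finally show ?thesis using assoc_mult_mat[OF wT N w(1)] by simp
  qed
  have "w\<^sup>T * (P * M * P * w) = w\<^sup>T * (P * (M * w))"
    using P' M w by (simp add: assoc_mult_mat[of _ d d _ d _ 1])
  also have "\<dots> = w\<^sup>T * (M * w)"
    using P' M w wP assoc_mult_mat[OF wT P'(1), of "M * w" 1] by simp
  finally show ?thesis using P' M by (simp add: energy)
qed

section \<open>Invariants of deflation\<close>

locale deflation_run =
  fixes d :: nat and M :: "real mat" and \<epsilon> :: real
    and orc :: "real mat \<Rightarrow> real mat \<Rightarrow> real vec"
  assumes psd: "psd_mat d M" and orc: "is_epca_oracle d \<epsilon> orc" and eps: "\<epsilon> < 1"
begin

abbreviation "P \<equiv> deflation_proj d M orc"

text \<open>The oracle's answers as one-column matrices, so that \<open>u i * (u i)\<^sup>T\<close> is the outer product.\<close>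

definition u :: "nat \<Rightarrow> real mat" where
  "u i = mat_of_cols d [orc M (P i)]"

lemma M_carrier: "M \<in> carrier_mat d d"
  using psd by (simp add: psd_mat_def)

lemma u_carrier: "u i \<in> carrier_mat d 1"
  by (simp add: u_def)

lemma P_Suc: "P (Suc i) = P i - u i * (u i)\<^sup>T"
  by (simp add: u_def Let_def)

declare deflation_proj.simps(2) [simp del]

lemma oracle_answer:
  assumes "orth_proj_mat d (P i)" "P i \<noteq> 0\<^sub>m d d"
  shows "orthonormal_cols d 1 (u i)" "P i * u i = u i"
    and "orc M (P i) \<in> carrier_vec d" "orc M (P i) \<bullet> orc M (P i) = 1"
    and "mat_inner (u i * (u i)\<^sup>T) (P i * M * P i) \<ge> (1 - \<epsilon>) * top_norm d 1 (P i * M * P i)"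
proof -
  interpret vec_space "TYPE(real)" d .
  let ?x = "orc M (P i)"
  have x: "?x \<in> col_space (P i)" "?x \<bullet> ?x = 1"
    and e: "is_epca d 1 \<epsilon> (P i * M * P i) (u i)"
    using orc psd assms by (auto simp: is_epca_oracle_def u_def)
  show "orthonormal_cols d 1 (u i)"
    and "mat_inner (u i * (u i)\<^sup>T) (P i * M * P i) \<ge> (1 - \<epsilon>) * top_norm d 1 (P i * M * P i)"
    using e by (auto simp: is_epca_def)
  show "?x \<bullet> ?x = 1" by fact
  have P: "P i \<in> carrier_mat d d" "P i * P i = P i"
    using assms by (auto simp: orth_proj_mat_def)
  obtain y where y: "y \<in> carrier_vec d" "?x = P i *\<^sub>v y"
    using x(1) P(1) by (auto simp: col_space_eq[OF P(1)])
  then show "?x \<in> carrier_vec d" using P by simp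
  have fx: "P i *\<^sub>v ?x = ?x"
    using y P assoc_mult_mat_vec[OF P(1) P(1) y(1)] by simp
  show "P i * u i = u i"
  proof (rule eq_matI)
    fix a b assume "a < dim_row (u i)" "b < dim_col (u i)"
    then have "a < d" "b = 0" by (auto simp: u_def)
    then have "(P i * u i) $$ (a, b) = (P i *\<^sub>v ?x) $ a"
      using P \<open>?x \<in> carrier_vec d\<close> by (simp add: u_def)
    also have "\<dots> = u i $$ (a, b)"
      using fx \<open>a < d\<close> \<open>b = 0\<close> by (simp add: u_def mat_of_cols_index)
    finally show "(P i * u i) $$ (a, b) = u i $$ (a, b)" .
  qed (use P in \<open>auto simp: u_def\<close>)
qed

text \<open>The trace shows that the oracle is never called on the zero projection, on which its behaviour
  is unspecified.\<close>

lemma P_proj: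
  assumes "i \<le> d"
  shows "orth_proj_mat d (P i)" and "mat_trace (P i) = real d - real i"
proof -
  have "orth_proj_mat d (P i) \<and> mat_trace (P i) = real d - real i"
    using assms
  proof (induction i)
    case 0
    then show ?case by (simp add: orth_proj_mat_one)
  next
    case (Suc i)
    then have IH: "orth_proj_mat d (P i)" "mat_trace (P i) = real d - real i" by auto
    have "P i \<noteq> 0\<^sub>m d d" using IH(2) Suc.prems by (auto simp: mat_trace_def)
    note ans = oracle_answer[OF IH(1) this]
    show ?case
      using orth_proj_mat_deflate[OF IH(1) ans(1,2)] IH(2) by (simp add: P_Suc)
  qed
  then show "orth_proj_mat d (P i)" and "mat_trace (P i) = real d - real i" by auto
qed

lemma P_nonzero: "i < d \<Longrightarrow> P i \<noteq> 0\<^sub>m d d"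
  using P_proj(2)[of i] by (auto simp: mat_trace_def)

lemmas answer = oracle_answer[OF P_proj(1)[OF less_imp_le] P_nonzero]

text \<open>Step \<open>i\<close> removes \<open>u i\<close> from the range, and later steps only shrink the range. Hence every
  later answer is orthogonal to \<open>u i\<close>.\<close>

lemma u_orthogonal_range:
  assumes "i < j" "j \<le> d"
  shows "P j * u i = 0\<^sub>m d 1"
  using assms
proof (induction j)
  case (Suc j)
  have j: "j < d" using Suc.prems by simp
  have P: "P j \<in> carrier_mat d d" "(P j)\<^sup>T = P j"
    using P_proj(1)[of j] j by (auto simp: orth_proj_mat_def)
  have uT: "(u j)\<^sup>T \<in> carrier_mat 1 d" using u_carrier by simp
  have expand: "P (Suc j) * u i = P j * u i - u j * ((u j)\<^sup>T * u i)"
    using P u_carrier[of i] u_carrier[of j] uT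
    by (simp add: P_Suc minus_mult_distrib_mat[of _ d d _ _ 1] assoc_mult_mat[of _ d 1 _ d _ 1])
  show ?case
  proof (cases "i = j")
    case True
    have "(u j)\<^sup>T * u j = 1\<^sub>m 1" using answer(1)[OF j j] by (simp add: orthonormal_cols_def)
    then show ?thesis
      unfolding expand unfolding True answer(2)[OF j j] using u_carrier[of j] by simp
  next
    case False
    then have IH: "P j * u i = 0\<^sub>m d 1" using Suc by simp
    have "(u j)\<^sup>T * u i = (u j)\<^sup>T * P j * u i"
      using transpose_mult[OF P(1) u_carrier[of j]] P answer(2)[OF j j] by simp
    also have "\<dots> = 0\<^sub>m 1 1"
      using assoc_mult_mat[OF uT P(1) u_carrier[of i]] IH uT by simp
    finally show ?thesis unfolding expand IH using u_carrier[of j] by simp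
  qed
qed simp

lemma oracle_answers_orthogonal:
  assumes "i < j" "j < d"
  shows "orc M (P i) \<bullet> orc M (P j) = 0"
proof -
  have P: "P j \<in> carrier_mat d d" "(P j)\<^sup>T = P j"
    using P_proj(1)[of j] assms by (auto simp: orth_proj_mat_def)
  have uT: "(u j)\<^sup>T \<in> carrier_mat 1 d" using u_carrier by simp
  have "(u j)\<^sup>T * u i = (u j)\<^sup>T * P j * u i"
    using transpose_mult[OF P(1) u_carrier[of j]] P answer(2)[of j] assms by simp
  also have "\<dots> = 0\<^sub>m 1 1"
    using assoc_mult_mat[OF uT P(1) u_carrier[of i]] u_orthogonal_range[OF assms(1)] assms uT
    by simp
  finally have "((u j)\<^sup>T * u i) $$ (0, 0) = 0" by simp
  moreover have "orc M (P i) \<in> carrier_vec d" "orc M (P j) \<in> carrier_vec d"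
    using answer(3) assms by auto
  ultimately show ?thesis
    using assms by (simp add: u_def comm_scalar_prod[of "orc M (P i)" d])
qed

lemma orthonormal_output:
  assumes "k \<le> d"
  shows "orthonormal_cols d k (black_box_pca d M k orc)"
proof -
  have x: "orc M (P i) \<in> carrier_vec d" if "i < k" for i
    using answer(3)[of i] that assms by simp
  have "orc M (P i) \<bullet> orc M (P j) = (if i = j then 1 else 0)" if "i < k" "j < k" for i j
    using answer(4)[of i] oracle_answers_orthogonal[of i j] oracle_answers_orthogonal[of j i]
      comm_scalar_prod[OF x[OF that(1)] x[OF that(2)]] that assms
    by (cases i j rule: linorder_cases) auto
  then show ?thesis
    using x by (auto simp: orthonormal_cols_def black_box_pca_def intro!: eq_matI)
qed

text \<open>The deflation steps telescope.\<close>

lemma output_outer_product: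
  assumes "k \<le> d"
  shows "black_box_pca d M k orc * (black_box_pca d M k orc)\<^sup>T = P 0 - P k"
proof -
  have entry: "P n $$ (a, b) = P 0 $$ (a, b) - (\<Sum>l<n. orc M (P l) $ a * orc M (P l) $ b)"
    if "n \<le> d" "a < d" "b < d" for n a b
    using that
  proof (induction n)
    case (Suc n)
    have "P n \<in> carrier_mat d d"
      using P_proj(1)[of n] Suc.prems by (auto simp: orth_proj_mat_def)
    then have "P (Suc n) $$ (a, b) = P n $$ (a, b) - orc M (P n) $ a * orc M (P n) $ b"
      using Suc.prems by (simp add: P_Suc u_def scalar_prod_def mat_of_cols_index)
    then show ?case using Suc by simp
  qed simp
  have "P k \<in> carrier_mat d d" "P 0 \<in> carrier_mat d d"
    using P_proj(1)[of k] assms by (auto simp: orth_proj_mat_def)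
  then show ?thesis
    using entry[OF assms]
    by (intro eq_matI)
      (auto simp: black_box_pca_def scalar_prod_def mat_of_cols_index atLeast0LessThan
        simp del: deflation_proj.simps)
qed

section \<open>Energy captured by deflation\<close>

text \<open>The hypothesis \<open>P i * Q = Q\<close> places the range of \<open>Q\<close> inside that of \<open>P i\<close>. The right-hand
  side is the energy of the answers \<open>u i, \<dots>, u (i + m - 1)\<close>. The induction varies \<open>Q\<close> and \<open>i\<close>:
  the step replaces \<open>Q\<close> by its part orthogonal to \<open>u i\<close>, which lies in the range of
  \<open>P (Suc i)\<close>, and pays for the removed unit vector \<open>w\<close> with the oracle's guarantee at \<open>i\<close>.\<close>

lemma energy_of_subprojection:
  assumes "orth_proj_mat d Q" "mat_trace Q = real m" "i + m \<le> d" "P i * Q = Q"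
  shows "(1 - \<epsilon>) * mat_inner Q M \<le> mat_inner (P i - P (i + m)) M"
  using assms
proof (induction m arbitrary: i Q)
  case 0
  have "Q = 0\<^sub>m d d" using orth_proj_mat_trace_zero[OF 0(1)] 0 by simp
  moreover have "P i - P i = 0\<^sub>m d d"
    using P_proj(1)[of i] 0 by (auto simp: orth_proj_mat_def)
  moreover have "mat_inner (0\<^sub>m d d) M = 0"
    using M_carrier by (simp add: mat_inner_def mat_trace_def)
  ultimately show ?case by simp
next
  case (Suc m)
  have i: "i < d" using Suc.prems by simp
  have proj: "orth_proj_mat d (P i)" using P_proj(1)[of i] i by simp
  have Pc: "P n \<in> carrier_mat d d" if "n \<le> d" for n
    using P_proj(1)[OF that] by (simp add: orth_proj_mat_def)
  have Q: "Q \<in> carrier_mat d d" "Q\<^sup>T = Q" using Suc.prems(1) by (auto simp: orth_proj_mat_def)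
  have Q0: "Q \<noteq> 0\<^sub>m d d" using Suc.prems(2) by (auto simp: mat_trace_def)
  obtain w where w: "orthonormal_cols d 1 w" "Q * w = w" "w * (w\<^sup>T * u i) = Q * u i"
    using ex_unit_capturing_projection[OF Suc.prems(1) Q0 u_carrier] .
  have wc: "w \<in> carrier_mat d 1" "w\<^sup>T \<in> carrier_mat 1 d"
    using w(1) by (auto simp: orthonormal_cols_def)
  have uc: "u i \<in> carrier_mat d 1" "(u i)\<^sup>T \<in> carrier_mat 1 d" using u_carrier by auto
  have Pw: "P i * w = w"
    using assoc_mult_mat[OF Pc Q(1) wc(1), of i] Suc.prems(4) w(2) i by simp
  define Q' where "Q' = Q - w * w\<^sup>T"
  have Q': "orth_proj_mat d Q'" "mat_trace Q' = real m"
    using orth_proj_mat_deflate[OF Suc.prems(1) w(1,2)] Suc.prems(2) by (auto simp: Q'_def)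
  then have Q'c: "Q' \<in> carrier_mat d d" "Q'\<^sup>T = Q'" by (auto simp: orth_proj_mat_def)
  have "Q' * u i = Q * u i - w * (w\<^sup>T * u i)"
    using Q wc uc
    by (simp add: Q'_def minus_mult_distrib_mat[of _ d d _ _ 1] assoc_mult_mat[of _ d 1 _ d _ 1])
  then have "Q' * u i = 0\<^sub>m d 1" using w(3) Q uc by auto
  then have uQ': "(u i)\<^sup>T * Q' = 0\<^sub>m 1 d"
    using transpose_mult[OF Q'c(1) uc(1)] Q'c(2) by simp
  have "P i * Q' = Q'"
    using Pc[of i] i Q wc Suc.prems(4) Pw
    by (simp add: Q'_def mult_minus_distrib_mat[of _ d d _ d]
        assoc_mult_mat[of _ d d _ 1 _ d, symmetric])
  then have "P (Suc i) * Q' = Q' - u i * ((u i)\<^sup>T * Q')"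
    using Pc[of i] i Q'c uc
    by (simp add: P_Suc minus_mult_distrib_mat[of _ d d _ _ d] assoc_mult_mat[of _ d 1 _ d _ d])
  then have PQ': "P (Suc i) * Q' = Q'" using uQ' Q'c uc by simp
  have IH: "(1 - \<epsilon>) * mat_inner Q' M \<le> mat_inner (P (Suc i) - P (Suc i + m)) M"
    using Suc.IH[OF Q' _ PQ'] Suc.prems(3) by simp
  \<comment> \<open>Since \<open>w\<close> lies in the range of \<open>P i\<close>, it competes in the supremum that the oracle approximates.\<close>
  have PMP: "P i * M * P i \<in> carrier_mat d d" using Pc[of i] i M_carrier by simp
  have "mat_inner (w * w\<^sup>T) M = mat_inner (w * w\<^sup>T) (P i * M * P i)"
    using rank_one_energy_compress[OF proj M_carrier wc(1) Pw] by simp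
  also have "\<dots> \<le> top_norm d 1 (P i * M * P i)"
    unfolding top_norm_def using w(1)
    by (intro cSUP_upper bdd_above_rank_one_energy[OF PMP]) auto
  finally have "(1 - \<epsilon>) * mat_inner (w * w\<^sup>T) M \<le> (1 - \<epsilon>) * top_norm d 1 (P i * M * P i)"
    using eps by simp
  also have "\<dots> \<le> mat_inner (u i * (u i)\<^sup>T) (P i * M * P i)"
    using answer(5)[OF i i] .
  also have "\<dots> = mat_inner (u i * (u i)\<^sup>T) M"
    using rank_one_energy_compress[OF proj M_carrier uc(1) answer(2)[OF i i]] .
  finally have step: "(1 - \<epsilon>) * mat_inner (w * w\<^sup>T) M \<le> mat_inner (u i * (u i)\<^sup>T) M" .
  have "mat_inner Q' M = mat_inner Q M - mat_inner (w * w\<^sup>T) M"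
    unfolding Q'_def using Q wc M_carrier by (intro mat_inner_minus_left) auto
  then have "(1 - \<epsilon>) * mat_inner Q M
      = (1 - \<epsilon>) * mat_inner Q' M + (1 - \<epsilon>) * mat_inner (w * w\<^sup>T) M"
    by (simp only: right_diff_distrib)
  moreover have "mat_inner (P (Suc i)) M = mat_inner (P i) M - mat_inner (u i * (u i)\<^sup>T) M"
    unfolding P_Suc using Pc[of i] i uc M_carrier by (intro mat_inner_minus_left) auto
  ultimately show ?case
    using IH step Suc.prems(3)
      mat_inner_minus_left[OF Pc[of i] Pc[of "i + Suc m"] M_carrier]
      mat_inner_minus_left[OF Pc[of "Suc i"] Pc[of "i + Suc m"] M_carrier]
    by simp
qed

lemma output_epca:
  assumes "k \<le> d"
  shows "is_epca d k \<epsilon> M (black_box_pca d M k orc)"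
proof -
  let ?U = "black_box_pca d M k orc"
  have U: "orthonormal_cols d k ?U" using orthonormal_output[OF assms] .
  have "top_norm d k M \<le> mat_inner (?U * ?U\<^sup>T) M / (1 - \<epsilon>)"
    unfolding top_norm_def
  proof (rule cSUP_least)
    show "{V. orthonormal_cols d k V} \<noteq> {}" using U by auto
    fix V assume "V \<in> {V. orthonormal_cols d k V}"
    then have V: "orthonormal_cols d k V" by simp
    note Q = orth_proj_mat_of_orthonormal_cols[OF V]
    have "(1 - \<epsilon>) * mat_inner (V * V\<^sup>T) M \<le> mat_inner (P 0 - P (0 + k)) M"
      using Q assms by (intro energy_of_subprojection) (auto simp: orth_proj_mat_def)
    then show "mat_inner (V * V\<^sup>T) M \<le> mat_inner (?U * ?U\<^sup>T) M / (1 - \<epsilon>)"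
      unfolding output_outer_product[OF assms] using eps by (simp add: field_simps)
  qed
  then show ?thesis using U eps by (simp add: is_epca_def field_simps)
qed

end

theorem theorem1:
  fixes \<epsilon> :: real and d k :: nat and M :: "real mat"
    and orc :: "real mat \<Rightarrow> real mat \<Rightarrow> real vec"
  assumes "0 < \<epsilon>" "\<epsilon> < 1"
    and "psd_mat d M"
    and "1 \<le> k" "k \<le> d"
    and "is_epca_oracle d \<epsilon> orc"
  shows "is_epca d k \<epsilon> M (black_box_pca d M k orc)"
proof -
  interpret deflation_run d M \<epsilon> orc
    using assms by unfold_locales
  show ?thesis using output_epca[OF assms(5)] .
qed

end
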